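(* Let $X$ be a compact topometric space with enough precise quotients, and let $\mathcal{Q}$ be a sufficient family of precise quotients of $X$. Then the following are equivalent: (i) $X$ is CB-analysable. (ii) All homomorphic images of $X$ are CB-analysable. (iii) All precise quotients of $X$ are CB-analysable. (iv) All $Y\in\mathcal{Q}$ admitting a countable base (of the topology) are CB-analysable.
   Context: A topometric space is a triple $(X,\mathscr{T},d)$ where $\mathscr{T}$ is a topology on $X$ and $d\colon X^2\to[0,\infty]$ is a metric (infinite distances allowed) such that (1) $d$ refines the topology: for every open $U$ and $x\in U$ there is $r>0$ with $\{y: d(x,y)<r\}\subseteq U$; (2) $d$ is lower semi-continuous: for every real $r\ge 0$ the set $\{(a,b): d(a,b)\le r\}$ is closed in $X^2$. Topological terms refer to $\mathscr{T}$. By convention $d(x,\varnothing)=\infty$ and $d(x,A)=\inf_{a\in A}d(x,a)$. For $X$ compact, a morphism $f\colon X\to Y$ of topometric spaces is a map that is topologically continuous and metrically uniformly continuous. A homomorphic image of $X$ is a topometric space $Y$ admitting a surjective morphism $X\to Y$. A map $f\colon X\to Y$ is precise if $d_Y(f(x),y)=d_X(x,f^{-1}(y))$ for all $x\in X$, $y\in Y$. A precise quotient of $X$ is a topometric space $Y$ together with a continuous, surjective, precise map $\pi\colon X\to Y$. The weight $\mathrm{wt}(Y)$ is the least cardinality of a base of the topology of $Y$. A family $\mathcal{Q}$ of (isomorphism classes of) precise quotients of $X$ is sufficient if for every $\mathfrak{B}\subseteq C(X,[0,1])$ there is $(Y,\pi)\in\mathcal{Q}$ such that $\mathrm{wt}(Y)\le|\mathfrak{B}|+\aleph_0$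 and every member of $\mathfrak{B}$ factors via $\pi$ (i.e. equals $f'\circ\pi$ with $f'\in C(Y,[0,1])$). $X$ has enough precise quotients if it admits a sufficient family of precise quotients. For $\varepsilon>0$ let $X'_{d,\varepsilon}=X\setminus\bigcup\{U\subseteq X\text{ open}: \mathrm{diam}(U)\le\varepsilon\}$; let $X^{(0)}_{d,\varepsilon}=X$, $X^{(\alpha+1)}_{d,\varepsilon}=(X^{(\alpha)}_{d,\varepsilon})'_{d,\varepsilon}$ (computed in the subspace with induced structure), and take intersections at limit ordinals. $X$ is CB-analysable if $\bigcap_\alpha X^{(\alpha)}_{d,\varepsilon}=\varnothing$ for every $\varepsilon>0$. (Using "open and $\varepsilon$-finite" or "open and $\varepsilon$-bounded" sets in place of open sets of diameter $\le\varepsilon$ gives an equivalent notion.) *)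

theory Defs
  imports "HOL-Analysis.Analysis"
begin

unbundle cardinal_syntax

section \<open>Topometric spaces\<close>

text \<open>
  The underlying set of a space is \<^term>\<open>topspace X\<close>; the values of the metric outside it are
  irrelevant.
\<close>

definition metric_on :: "'a set \<Rightarrow> ('a \<Rightarrow> 'a \<Rightarrow> ennreal) \<Rightarrow> bool" where
  "metric_on S d \<longleftrightarrow>
     (\<forall>x\<in>S. \<forall>y\<in>S. d x y = 0 \<longleftrightarrow> x = y) \<and>
     (\<forall>x\<in>S. \<forall>y\<in>S. d x y = d y x) \<and>
     (\<forall>x\<in>S. \<forall>y\<in>S. \<forall>z\<in>S. d x z \<le> d x y + d y z)"

definition topometric_space :: "'a topology \<Rightarrow> ('a \<Rightarrow> 'a \<Rightarrow> ennreal) \<Rightarrow> bool" where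
  "topometric_space X d \<longleftrightarrow>
     metric_on (topspace X) d \<and>
     (\<forall>U x. openin X U \<and> x \<in> U \<longrightarrow>
        (\<exists>r::real. r > 0 \<and> {y \<in> topspace X. d x y < ennreal r} \<subseteq> U)) \<and>
     (\<forall>r::real. r \<ge> 0 \<longrightarrow>
        closedin (prod_topology X X)
          {(a, b). a \<in> topspace X \<and> b \<in> topspace X \<and> d a b \<le> ennreal r})"

text \<open>In \<^typ>\<open>ennreal\<close> the infimum of the empty set is \<open>\<infinity>\<close>, so the distance to
  the empty set is \<open>\<infinity>\<close>; likewise the diameter of the empty set is \<open>0\<close>.\<close>

definition dist_to_set :: "('a \<Rightarrow> 'a \<Rightarrow> ennreal) \<Rightarrow> 'a \<Rightarrow> 'a set \<Rightarrow> ennreal" where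
  "dist_to_set d x A = (INF a\<in>A. d x a)"

definition ediam :: "('a \<Rightarrow> 'a \<Rightarrow> ennreal) \<Rightarrow> 'a set \<Rightarrow> ennreal" where
  "ediam d U = (SUP x\<in>U. SUP y\<in>U. d x y)"


section \<open>Morphisms, homomorphic images, precise quotients\<close>

definition topometric_morphism ::
  "'a topology \<Rightarrow> ('a \<Rightarrow> 'a \<Rightarrow> ennreal) \<Rightarrow> 'b topology \<Rightarrow> ('b \<Rightarrow> 'b \<Rightarrow> ennreal) \<Rightarrow> ('a \<Rightarrow> 'b) \<Rightarrow> bool"
  where
  "topometric_morphism X dX Y dY f \<longleftrightarrow>
     continuous_map X Y f \<and>
     (\<forall>e::real. e > 0 \<longrightarrow> (\<exists>\<delta>::real. \<delta> > 0 \<and>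
        (\<forall>x\<in>topspace X. \<forall>x'\<in>topspace X.
           dX x x' < ennreal \<delta> \<longrightarrow> dY (f x) (f x') < ennreal e)))"

definition homomorphic_image ::
  "'a topology \<Rightarrow> ('a \<Rightarrow> 'a \<Rightarrow> ennreal) \<Rightarrow> 'b topology \<Rightarrow> ('b \<Rightarrow> 'b \<Rightarrow> ennreal) \<Rightarrow> bool" where
  "homomorphic_image X dX Y dY \<longleftrightarrow>
     topometric_space Y dY \<and>
     (\<exists>f. topometric_morphism X dX Y dY f \<and> f ` topspace X = topspace Y)"

definition precise_map ::
  "'a topology \<Rightarrow> ('a \<Rightarrow> 'a \<Rightarrow> ennreal) \<Rightarrow> 'b topology \<Rightarrow> ('b \<Rightarrow> 'b \<Rightarrow> ennreal) \<Rightarrow> ('a \<Rightarrow> 'b) \<Rightarrow> bool"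
  where
  "precise_map X dX Y dY f \<longleftrightarrow>
     (\<forall>x\<in>topspace X. \<forall>y\<in>topspace Y.
        dY (f x) y = dist_to_set dX x {x' \<in> topspace X. f x' = y})"

definition precise_quotient ::
  "'a topology \<Rightarrow> ('a \<Rightarrow> 'a \<Rightarrow> ennreal) \<Rightarrow> 'b topology \<Rightarrow> ('b \<Rightarrow> 'b \<Rightarrow> ennreal) \<Rightarrow> ('a \<Rightarrow> 'b) \<Rightarrow> bool"
  where
  "precise_quotient X dX Y dY \<pi> \<longleftrightarrow>
     topometric_space Y dY \<and> continuous_map X Y \<pi> \<and> \<pi> ` topspace X = topspace Y \<and>
     precise_map X dX Y dY \<pi>"


section \<open>Weight and sufficient families\<close>

definition is_base :: "'a topology \<Rightarrow> 'a set set \<Rightarrow> bool" where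
  "is_base X B \<longleftrightarrow>
     (\<forall>V\<in>B. openin X V) \<and> (\<forall>U. openin X U \<longrightarrow> (\<exists>C\<subseteq>B. U = \<Union>C))"

definition has_countable_base :: "'a topology \<Rightarrow> bool" where
  "has_countable_base X \<longleftrightarrow> (\<exists>B. countable B \<and> is_base X B)"

definition weight :: "'a topology \<Rightarrow> 'a set rel" where
  "weight X = |SOME B. is_base X B \<and> (\<forall>B'. is_base X B' \<longrightarrow> |B| \<le>o |B'| )|"

lemma weight_is_least:
  shows "\<exists>B. is_base X B \<and> weight X = |B|"
    and "is_base X B' \<Longrightarrow> weight X \<le>o |B'|"
proof -
  have "is_base X (Collect (openin X))"
    unfolding is_base_def by blast
  then have "card_of ` Collect (is_base X) \<noteq> {}"
    by blast
  moreover have "\<forall>r \<in> card_of ` Collect (is_base X). Card_order r"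
    by (auto simp: card_of_Card_order)
  ultimately have "\<exists>r \<in> card_of ` Collect (is_base X). \<forall>r' \<in> card_of ` Collect (is_base X). r \<le>o r'"
    by (rule exists_minim_Card_order)
  then have "\<exists>B. is_base X B \<and> (\<forall>B'. is_base X B' \<longrightarrow> |B| \<le>o |B'| )"
    by blast
  from someI_ex[OF this]
  show "\<exists>B. is_base X B \<and> weight X = |B|" and "is_base X B' \<Longrightarrow> weight X \<le>o |B'|"
    unfolding weight_def by blast+
qed

text \<open>Functions on the space are taken to be extensional, so that the cardinality of a set of
  functions does not depend on values outside the space.\<close>

definition C01 :: "'a topology \<Rightarrow> ('a \<Rightarrow> real) set" where
  "C01 X = {f \<in> extensional (topspace X). continuous_map X (top_of_set {0..1}) f}"

type_synonym ('a, 'b) quotient_data = "'b topology \<times> ('b \<Rightarrow> 'b \<Rightarrow> ennreal) \<times> ('a \<Rightarrow> 'b)"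

definition sufficient_family ::
  "'a topology \<Rightarrow> ('a \<Rightarrow> 'a \<Rightarrow> ennreal) \<Rightarrow> ('a, 'b) quotient_data set \<Rightarrow> bool" where
  "sufficient_family X d \<Q> \<longleftrightarrow>
     (\<forall>(Y, dY, \<pi>) \<in> \<Q>. precise_quotient X d Y dY \<pi>) \<and>
     (\<forall>\<B> \<subseteq> C01 X. \<exists>(Y, dY, \<pi>) \<in> \<Q>.
        weight Y \<le>o |\<B>| +c natLeq \<and>
        (\<forall>f\<in>\<B>. \<exists>f' \<in> C01 Y. \<forall>x\<in>topspace X. f x = f' (\<pi> x)))"

text \<open>Every quotient of \<open>X\<close> is isomorphic to one carried by a set of representatives
  in \<open>X\<close>, so quotients living on \<^typ>\<open>'a\<close> cover all isomorphism classes.\<close>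

definition enough_precise_quotients :: "'a topology \<Rightarrow> ('a \<Rightarrow> 'a \<Rightarrow> ennreal) \<Rightarrow> bool" where
  "enough_precise_quotients X d \<longleftrightarrow>
     (\<exists>\<Q> :: ('a, 'a) quotient_data set. sufficient_family X d \<Q>)"


section \<open>Cantor-Bendixson analysis\<close>

definition cb_deriv :: "'a topology \<Rightarrow> ('a \<Rightarrow> 'a \<Rightarrow> ennreal) \<Rightarrow> real \<Rightarrow> 'a set \<Rightarrow> 'a set" where
  "cb_deriv X d e A = A - \<Union>{U. openin (subtopology X A) U \<and> ediam d U \<le> ennreal e}"

text \<open>Ordinals are represented by the elements of the field of a well-order \<open>r\<close>, an element
  standing for the order type of its set \<^term>\<open>underS r i\<close> of strict predecessors.\<close>

definition is_wo_pred :: "'i rel \<Rightarrow> 'i \<Rightarrow> 'i \<Rightarrow> bool" where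
  "is_wo_pred r i j \<longleftrightarrow> j \<in> underS r i \<and> (\<forall>k \<in> underS r i. (k, j) \<in> r)"

definition cb_stage ::
  "'i rel \<Rightarrow> 'a topology \<Rightarrow> ('a \<Rightarrow> 'a \<Rightarrow> ennreal) \<Rightarrow> real \<Rightarrow> 'i \<Rightarrow> 'a set" where
  "cb_stage r X d e = wo_rel.worec r (\<lambda>S i.
     if underS r i = {} then topspace X
     else if \<exists>j. is_wo_pred r i j then cb_deriv X d e (S (THE j. is_wo_pred r i j))
     else (\<Inter>j \<in> underS r i. S j))"

text \<open>The well-order \<^term>\<open>|UNIV :: 'a set set|\<close> is longer than every strictly decreasing
  sequence of subsets of \<^typ>\<open>'a\<close>; hence the intersection over it is the intersection over
  all ordinals, as made precise by \<open>cb_kernel_subset_stage\<close> below.\<close>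

definition cb_kernel :: "'a topology \<Rightarrow> ('a \<Rightarrow> 'a \<Rightarrow> ennreal) \<Rightarrow> real \<Rightarrow> 'a set" where
  "cb_kernel X d e = (\<Inter>i \<in> Field |UNIV :: 'a set set|. cb_stage |UNIV :: 'a set set| X d e i)"

definition CB_analysable :: "'a topology \<Rightarrow> ('a \<Rightarrow> 'a \<Rightarrow> ennreal) \<Rightarrow> bool" where
  "CB_analysable X d \<longleftrightarrow> (\<forall>e::real. e > 0 \<longrightarrow> cb_kernel X d e = {})"

lemma is_wo_pred_unique:
  assumes "Well_order r" "is_wo_pred r i j" "is_wo_pred r i k"
  shows "j = k"
  using assms wo_rel.ANTISYM[of r] unfolding is_wo_pred_def wo_rel_def antisym_def by blast

lemma cb_stage_unfold:
  assumes "Well_order r"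
  shows "cb_stage r X d e i =
     (if underS r i = {} then topspace X
      else if \<exists>j. is_wo_pred r i j then cb_deriv X d e (cb_stage r X d e (THE j. is_wo_pred r i j))
      else (\<Inter>j \<in> underS r i. cb_stage r X d e j))"
proof -
  let ?H = "\<lambda>S i. if underS r i = {} then topspace X
     else if \<exists>j. is_wo_pred r i j then cb_deriv X d e (S (THE j. is_wo_pred r i j))
     else (\<Inter>j \<in> underS r i. S j)"
  have wo: "wo_rel r"
    using assms by (simp add: wo_rel_def)
  have "wo_rel.adm_wo r ?H"
    unfolding wo_rel.adm_wo_def[OF wo]
  proof (intro allI impI)
    fix f g :: "'a \<Rightarrow> 'b set" and x
    assume eq: "\<forall>y\<in>underS r x. f y = g y"
    have "f (THE j. is_wo_pred r x j) = g (THE j. is_wo_pred r x j)" if "is_wo_pred r x j" for j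
    proof -
      have "(THE j. is_wo_pred r x j) = j"
        using that is_wo_pred_unique[OF assms] by blast
      then show ?thesis
        using that eq unfolding is_wo_pred_def by simp
    qed
    then show "?H f x = ?H g x"
      using eq by auto
  qed
  from wo_rel.worec_fixpoint[OF wo this] show ?thesis
    unfolding cb_stage_def by (rule fun_cong)
qed

lemma cb_stage_zero:
  assumes "Well_order r" "underS r i = {}"
  shows "cb_stage r X d e i = topspace X"
  by (subst cb_stage_unfold[OF assms(1)]) (simp add: assms(2))

lemma cb_stage_succ:
  assumes "Well_order r" "is_wo_pred r i j"
  shows "cb_stage r X d e i = cb_deriv X d e (cb_stage r X d e j)"
proof -
  have "(THE j. is_wo_pred r i j) = j"
    using assms is_wo_pred_unique[OF assms(1)] by blast
  moreover have "underS r i \<noteq> {}"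
    using assms(2) unfolding is_wo_pred_def by blast
  ultimately show ?thesis
    using assms(2) by (subst cb_stage_unfold[OF assms(1)]) auto
qed

lemma cb_stage_limit:
  assumes "Well_order r" "underS r i \<noteq> {}" "\<nexists>j. is_wo_pred r i j"
  shows "cb_stage r X d e i = (\<Inter>j \<in> underS r i. cb_stage r X d e j)"
  by (subst cb_stage_unfold[OF assms(1)]) (simp only: assms(2,3) if_False)

lemma cb_deriv_subset: "cb_deriv X d e A \<subseteq> A"
  unfolding cb_deriv_def by blast

lemma ediam_mono: "U \<subseteq> V \<Longrightarrow> ediam d U \<le> ediam d V"
  unfolding ediam_def by (intro SUP_subset_mono) auto

lemma cb_deriv_mono:
  assumes "A \<subseteq> B"
  shows "cb_deriv X d e A \<subseteq> cb_deriv X d e B"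
proof
  fix x assume x: "x \<in> cb_deriv X d e A"
  have "x \<notin> U" if U: "openin (subtopology X B) U" "ediam d U \<le> ennreal e" for U
  proof
    assume "x \<in> U"
    from U(1) obtain T where T: "openin X T" "U = T \<inter> B"
      unfolding openin_subtopology by blast
    then have "openin (subtopology X A) (T \<inter> A)"
      unfolding openin_subtopology by blast
    moreover have "ediam d (T \<inter> A) \<le> ennreal e"
      using ediam_mono[of "T \<inter> A" U d] T(2) assms U(2) by (meson Int_mono order_refl order_trans)
    ultimately show False
      using x \<open>x \<in> U\<close> T(2) unfolding cb_deriv_def by blast
  qed
  then show "x \<in> cb_deriv X d e B"
    using x assms unfolding cb_deriv_def by blast
qed

lemma cb_stage_antimono:
  assumes r: "Well_order r" and ij: "i \<in> underS r j"
  shows "cb_stage r X d e j \<subseteq> cb_deriv X d e (cb_stage r X d e i)"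
  using ij
proof (induction j rule: wo_rel.well_order_induct[of r, unfolded wo_rel_def, OF r])
  case (1 j)
  have trans: "trans r" and antisym: "antisym r"
    using r wo_rel.TRANS wo_rel.ANTISYM unfolding wo_rel_def by blast+
  have IH: "cb_stage r X d e k \<subseteq> cb_deriv X d e (cb_stage r X d e i)"
    if "k \<in> underS r j" "i \<in> underS r k" for k
    using 1(1) that unfolding underS_def by blast
  show ?case
  proof (cases "\<exists>k. is_wo_pred r j k")
    case True
    then obtain k where k: "is_wo_pred r j k"
      by blast
    show ?thesis
    proof (cases "i = k")
      case True
      then show ?thesis
        using cb_stage_succ[OF r k, of X d e] by simp
    next
      case False
      then have "i \<in> underS r k" "k \<in> underS r j"
        using k 1(2) unfolding is_wo_pred_def underS_def by auto
      then show ?thesis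
        using IH[of k] cb_stage_succ[OF r k, of X d e] cb_deriv_subset[of X d e "cb_stage r X d e k"] by blast
    qed
  next
    case False
    then obtain k where k: "k \<in> underS r j" "(k, i) \<notin> r"
      using 1(2) unfolding is_wo_pred_def by blast
    have "i \<in> Field r" "k \<in> Field r"
      using k(1) 1(2) unfolding underS_def Field_def by auto
    then have "(i, k) \<in> r"
      using k(2) r wo_rel.TOTALS[of r] unfolding wo_rel_def by blast
    moreover have "i \<noteq> k"
      using k(2) calculation by blast
    ultimately have "i \<in> underS r k"
      unfolding underS_def by blast
    moreover have "cb_stage r X d e j \<subseteq> cb_stage r X d e k"
      using cb_stage_limit[OF r _ False, of X d e] k(1) by blast
    ultimately show ?thesis
      using IH[OF k(1)] by blast
  qed
qed

lemma fixed_subset_cb_stage: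
  assumes r: "Well_order r" and A: "cb_deriv X d e A = A" "A \<subseteq> topspace X"
  shows "A \<subseteq> cb_stage r X d e i"
proof (induction i rule: wo_rel.well_order_induct[of r, unfolded wo_rel_def, OF r])
  case (1 i)
  then have IH: "A \<subseteq> cb_stage r X d e j" if "j \<in> underS r i" for j
    using that unfolding underS_def by blast
  consider "underS r i = {}" | j where "is_wo_pred r i j"
    | "underS r i \<noteq> {}" "\<nexists>j. is_wo_pred r i j"
    by blast
  then show ?case
  proof cases
    case 1
    then show ?thesis
      using cb_stage_zero[OF r 1, of X d e] A(2) by simp
  next
    case (2 j)
    then have "A \<subseteq> cb_stage r X d e j"
      using IH unfolding is_wo_pred_def by blast
    then show ?thesis
      using cb_deriv_mono[of A "cb_stage r X d e j" X d e] A(1) cb_stage_succ[OF r 2, of X d e] by simp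
  next
    case 3
    then show ?thesis
      using cb_stage_limit[OF r 3, of X d e] IH by blast
  qed
qed

lemma cb_stage_subset_topspace:
  assumes r: "Well_order r"
  shows "cb_stage r X d e i \<subseteq> topspace X"
proof (induction i rule: wo_rel.well_order_induct[of r, unfolded wo_rel_def, OF r])
  case (1 i)
  then have IH: "cb_stage r X d e j \<subseteq> topspace X" if "j \<in> underS r i" for j
    using that unfolding underS_def by blast
  consider "underS r i = {}" | j where "is_wo_pred r i j"
    | "underS r i \<noteq> {}" "\<nexists>j. is_wo_pred r i j"
    by blast
  then show ?case
  proof cases
    case 1
    then show ?thesis
      using cb_stage_zero[OF r 1, of X d e] by simp
  next
    case (2 j)
    then have "cb_stage r X d e j \<subseteq> topspace X"
      using IH unfolding is_wo_pred_def by blast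
    then show ?thesis
      using cb_deriv_subset[of X d e "cb_stage r X d e j"] cb_stage_succ[OF r 2, of X d e] by blast
  next
    case 3
    then show ?thesis
      using cb_stage_limit[OF r 3, of X d e] IH by blast
  qed
qed

lemma cb_kernel_eq_stage:
  fixes X :: "'a topology"
  obtains i where "cb_kernel X d e = cb_stage |UNIV :: 'a set set| X d e i"
    and "cb_deriv X d e (cb_kernel X d e) = cb_kernel X d e"
proof -
  let ?r = "|UNIV :: 'a set set|"
  let ?S = "cb_stage ?r X d e"
  have r: "Well_order ?r"
    by (rule card_of_Well_order)
  have F: "Field ?r = UNIV"
    by (rule Field_card_of)
  have "\<exists>i. cb_deriv X d e (?S i) = ?S i"
  proof (rule ccontr)
    assume "\<not> ?thesis"
    then have "\<exists>x. x \<in> ?S i - cb_deriv X d e (?S i)" for i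
      using cb_deriv_subset[of X d e "?S i"] by (metis Diff_eq_empty_iff equals0I subset_antisym)
    then obtain x where "\<And>i. x i \<in> ?S i - cb_deriv X d e (?S i)"
      by metis
    then have x: "x i \<in> ?S i" "x i \<notin> cb_deriv X d e (?S i)" for i
      by blast+
    have neq: "x i \<noteq> x j" if "i \<in> underS ?r j" for i j
      using cb_stage_antimono[OF r that, of X d e] x[of i] x[of j] by auto
    have "inj x"
    proof (rule injI, rule ccontr)
      fix i j assume "x i = x j" "i \<noteq> j"
      moreover have "(i, j) \<in> ?r \<or> (j, i) \<in> ?r"
        using r wo_rel.TOTALS[of ?r] F unfolding wo_rel_def by blast
      ultimately show False
        using neq[of i j] neq[of j i] unfolding underS_def by auto
    qed
    then have "surj (inv x)"
      by (rule inj_imp_surj_inv)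
    then show False
      using Cantors_theorem[of "UNIV :: 'a set"] by auto
  qed
  then obtain i where i: "cb_deriv X d e (?S i) = ?S i"
    by blast
  have "?S i \<subseteq> ?S j" for j
    using fixed_subset_cb_stage[OF r i cb_stage_subset_topspace[OF r]] .
  then have "cb_kernel X d e = ?S i"
    unfolding cb_kernel_def F by blast
  with i that show ?thesis
    by simp
qed

lemma cb_kernel_subset_stage:
  fixes X :: "'a topology"
  assumes "Well_order r"
  shows "cb_kernel X d e \<subseteq> cb_stage r X d e i"
proof -
  obtain j where j: "cb_kernel X d e = cb_stage |UNIV :: 'a set set| X d e j"
    and fixp: "cb_deriv X d e (cb_kernel X d e) = cb_kernel X d e"
    by (rule cb_kernel_eq_stage)
  have "cb_kernel X d e \<subseteq> topspace X"
    unfolding j by (rule cb_stage_subset_topspace[OF card_of_Well_order])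
  with fixp show ?thesis
    by (rule fixed_subset_cb_stage[OF assms])
qed

end

theory Submission
  imports Defs "HOL-Library.Countable_Set_Type"
begin

text \<open>
  A compact topometric space is CB-analysable iff for each \<open>e > 0\<close> every nonempty closed subset has a
  nonempty relatively open piece of diameter at most \<open>e\<close>
  (\<open>CB_analysable_iff_closed_fragmented\<close>). Both halves of the equivalence rest on one application of
  Zorn's lemma (\<open>minimal_closed_transversal\<close>): given nonempty closed sets in a compact space, a
  minimal closed set \<open>B\<close> meeting all of them has the property that a nonempty relatively open piece
  of \<open>B\<close>, however small, contains the whole trace on \<open>B\<close> of one of the given sets.

  \<^item> Analysability passes to homomorphic images. For closed \<open>A \<subseteq> Y\<close>, let \<open>B\<close> be a minimal closed set
    meeting all fibres over \<open>A\<close>. A small relatively open piece of \<open>B\<close> contains the trace of a whole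
    fibre, and therefore its image contains a nonempty relatively open piece of \<open>A\<close>, which is small
    by uniform continuity.

  \<^item> Failure of analysability is seen by a quotient of countable weight. If every nonempty
    relatively open piece of a nonempty closed \<open>A \<subseteq> X\<close> has diameter above \<open>e\<close>, then each such piece
    contains two points at distance above \<open>e\<close>. By semi-continuity they have neighbourhoods that far
    apart, and Urysohn functions single out smaller ones. Iteration yields a countable family of functions whose sublevel sets form a binary tree, in which siblings
    lie at distance at least \<open>e\<close>. In a precise quotient through which all these functions factor,
    their sublevel sets still form such a tree. A minimal closed set meeting every member of the
    tree then has no small open piece, since any nonempty open piece of it meets two siblings.

  On any type into which \<open>X\<close> embeds there is an isometric copy of \<open>X\<close> (\<open>isometric_copy\<close>). It is a
  precise quotient of \<open>X\<close>, and so analysability of the quotients on that type gives back that of \<open>X\<close>.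
\<close>

section \<open>Analysability as fragmentation of closed sets\<close>

lemma CB_analysable_iff_closed_fragmented:
  fixes X :: "'a topology"
  shows "CB_analysable X d \<longleftrightarrow>
    (\<forall>e::real. e > 0 \<longrightarrow> (\<forall>A. closedin X A \<and> A \<noteq> {} \<longrightarrow>
       (\<exists>U. openin X U \<and> U \<inter> A \<noteq> {} \<and> ediam d (U \<inter> A) \<le> ennreal e)))"
    (is "_ \<longleftrightarrow> ?F")
proof
  assume cb: "CB_analysable X d"
  show ?F
  proof (intro allI impI, rule ccontr)
    fix e :: real and A
    assume e: "e > 0" and A: "closedin X A \<and> A \<noteq> {}"
      and no: "\<nexists>U. openin X U \<and> U \<inter> A \<noteq> {} \<and> ediam d (U \<inter> A) \<le> ennreal e"
    have "cb_deriv X d e A = A"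
      using no unfolding cb_deriv_def openin_subtopology by blast
    moreover obtain i where "cb_kernel X d e = cb_stage |UNIV :: 'a set set| X d e i"
      by (rule cb_kernel_eq_stage)
    ultimately have "A \<subseteq> cb_kernel X d e"
      using fixed_subset_cb_stage[OF card_of_Well_order] closedin_subset A by metis
    then show False
      using cb e A unfolding CB_analysable_def by blast
  qed
next
  assume F: ?F
  show "CB_analysable X d"
    unfolding CB_analysable_def
  proof (intro allI impI, rule ccontr)
    fix e :: real
    assume e: "e > 0" and ne: "cb_kernel X d e \<noteq> {}"
    let ?K = "cb_kernel X d e"
    obtain i where i: "?K = cb_stage |UNIV :: 'a set set| X d e i"
      and fixp: "cb_deriv X d e ?K = ?K"
      by (rule cb_kernel_eq_stage)
    have K: "?K \<subseteq> topspace X"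
      unfolding i by (rule cb_stage_subset_topspace[OF card_of_Well_order])
    \<comment> \<open>The kernel is not known to be closed; an open set meeting its closure meets the kernel itself.\<close>
    have sub: "?K \<subseteq> X closure_of ?K"
      by (rule closure_of_subset[OF K])
    then obtain U where U: "openin X U" "U \<inter> X closure_of ?K \<noteq> {}"
      "ediam d (U \<inter> X closure_of ?K) \<le> ennreal e"
      using F e ne by (metis closedin_closure_of subset_empty)
    have "U \<inter> ?K \<noteq> {}"
      using U(1,2) openin_Int_closure_of_eq_empty by blast
    moreover have "ediam d (U \<inter> ?K) \<le> ennreal e"
      using U(3) ediam_mono[of "U \<inter> ?K" "U \<inter> X closure_of ?K" d] sub by (meson Int_mono order_refl order_trans)
    moreover have "openin (subtopology X ?K) (U \<inter> ?K)"
      using U(1) unfolding openin_subtopology by blast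
    ultimately have "cb_deriv X d e ?K \<noteq> ?K"
      unfolding cb_deriv_def by blast
    then show False
      using fixp by blast
  qed
qed

text \<open>The last property of \<open>B\<close> is minimality among closed sets meeting all members of \<open>\<G>\<close>, in the
  form in which it is used: \<open>B - U\<close> misses some member. Zorn's lemma is applied to the complements,
  where compactness of the members makes unions of chains admissible.\<close>

lemma minimal_closed_transversal:
  assumes X: "compact_space X" and members: "\<forall>G\<in>\<G>. closedin X G \<and> G \<noteq> {}"
  shows "\<exists>B. closedin X B \<and> (\<forall>G\<in>\<G>. G \<inter> B \<noteq> {}) \<and>
    (\<forall>U. openin X U \<and> U \<inter> B \<noteq> {} \<longrightarrow> (\<exists>G\<in>\<G>. G \<inter> B \<subseteq> U))"
proof -
  note \<G> = bspec[OF members]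
  let ?\<A> = "{W. openin X W \<and> (\<forall>G\<in>\<G>. \<not> G \<subseteq> W)}"
  have "\<exists>M\<in>?\<A>. \<forall>W\<in>?\<A>. M \<subseteq> W \<longrightarrow> W = M"
  proof (rule subset_Zorn_nonempty)
    have "{} \<in> ?\<A>"
      using \<G> by auto
    then show "?\<A> \<noteq> {}"
      by blast
    fix \<C> assume ne: "\<C> \<noteq> {}" and chain: "subset.chain ?\<A> \<C>"
    have \<C>: "\<C> \<subseteq> ?\<A>"
      using chain unfolding subset.chain_def by blast
    have "\<not> G \<subseteq> \<Union>\<C>" if G: "G \<in> \<G>" for G
    proof
      assume "G \<subseteq> \<Union>\<C>"
      moreover have "compactin X G"
        using \<G>[OF G] X by (simp add: closedin_compact_space)
      ultimately obtain \<F> where \<F>: "finite \<F>" "\<F> \<subseteq> \<C>" "G \<subseteq> \<Union>\<F>"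
        using compactinD[of X G \<C>] \<C> by blast
      have "\<F> \<noteq> {}"
        using \<F>(3) \<G>[OF G] by auto
      then have "\<Union>\<F> \<in> \<F>"
        using Union_in_chain[of \<F> ?\<A>] \<F>(1,2) chain unfolding subset.chain_def by blast
      then show False
        using \<F>(2,3) \<C> G by blast
    qed
    moreover have "openin X (\<Union>\<C>)"
      using \<C> by blast
    ultimately show "\<Union>\<C> \<in> ?\<A>"
      by blast
  qed
  then obtain M where "M \<in> ?\<A>" and max: "\<forall>W\<in>?\<A>. M \<subseteq> W \<longrightarrow> W = M"
    by (rule bexE)
  then have M: "openin X M" "\<And>G. G \<in> \<G> \<Longrightarrow> \<not> G \<subseteq> M"
    by simp_all
  show ?thesis
  proof (intro exI[of _ "topspace X - M"] conjI ballI allI impI)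
    show "closedin X (topspace X - M)"
      by (rule closedin_diff[OF closedin_topspace M(1)])
    show "G \<inter> (topspace X - M) \<noteq> {}" if "G \<in> \<G>" for G
    proof -
      have "G \<subseteq> topspace X"
        using \<G>[OF that] by (simp add: closedin_subset)
      then show ?thesis
        using M(2)[OF that] by blast
    qed
    show "\<exists>G\<in>\<G>. G \<inter> (topspace X - M) \<subseteq> U" if U: "openin X U \<and> U \<inter> (topspace X - M) \<noteq> {}" for U
    proof -
      have "M \<union> U \<noteq> M"
        using U by blast
      then have "M \<union> U \<notin> ?\<A>"
        using bspec[OF max, of "M \<union> U"] by auto
      moreover have "openin X (M \<union> U)"
        using M(1) U by (simp add: openin_Un)
      ultimately obtain G where "G \<in> \<G>" "G \<subseteq> M \<union> U"
        by auto
      then show ?thesis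
        by (intro bexI[of _ G]) auto
    qed
  qed
qed

section \<open>Homomorphic images\<close>

lemma topometric_space_imp_Hausdorff:
  assumes "topometric_space X d"
  shows "Hausdorff_space X"
proof -
  have "{(a, b). a \<in> topspace X \<and> b \<in> topspace X \<and> d a b \<le> ennreal 0} = (\<lambda>x. (x, x)) ` topspace X"
    using assms unfolding topometric_space_def metric_on_def by auto
  moreover have "closedin (prod_topology X X)
      {(a, b). a \<in> topspace X \<and> b \<in> topspace X \<and> d a b \<le> ennreal 0}"
    using assms unfolding topometric_space_def by blast
  ultimately show ?thesis
    by (simp add: Hausdorff_space_closedin_diagonal)
qed

lemma CB_analysable_homomorphic_image:
  assumes X: "compact_space X" and cb: "CB_analysable X dX" and Y: "homomorphic_image X dX Y dY"
  shows "CB_analysable Y dY"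
  unfolding CB_analysable_iff_closed_fragmented
proof (intro allI impI)
  fix e :: real and A
  assume e: "e > 0" and "closedin Y A \<and> A \<noteq> {}"
  then have A: "closedin Y A" "A \<noteq> {}"
    by auto
  obtain f where f: "continuous_map X Y f" "f ` topspace X = topspace Y"
    and uc: "\<forall>e::real. e > 0 \<longrightarrow> (\<exists>\<delta>::real. \<delta> > 0 \<and>
        (\<forall>x\<in>topspace X. \<forall>x'\<in>topspace X. dX x x' < ennreal \<delta> \<longrightarrow> dY (f x) (f x') < ennreal e))"
    using Y unfolding homomorphic_image_def topometric_morphism_def by blast
  have T2: "Hausdorff_space Y"
    using Y topometric_space_imp_Hausdorff unfolding homomorphic_image_def by blast
  have cm: "closed_map X Y f"
    by (rule continuous_imp_closed_map[OF f(1) X T2])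
  obtain \<delta> :: real where \<delta>: "\<delta> > 0" "\<And>x x'. \<lbrakk>x \<in> topspace X; x' \<in> topspace X; dX x x' < ennreal \<delta>\<rbrakk>
      \<Longrightarrow> dY (f x) (f x') < ennreal e"
    using uc e by blast
  let ?fib = "\<lambda>a. {x \<in> topspace X. f x = a}"
  have fib: "\<forall>G\<in>?fib ` A. closedin X G \<and> G \<noteq> {}"
  proof
    fix G assume G: "G \<in> ?fib ` A"
    obtain a where a: "a \<in> A" "G = ?fib a"
      using G by blast
    have a': "a \<in> topspace Y"
      using a(1) A(1) closedin_subset by blast
    then have "closedin Y {a}"
      using T2 by (simp add: closedin_Hausdorff_singleton)
    then have "closedin X {x \<in> topspace X. f x \<in> {a}}"
      by (rule closedin_continuous_map_preimage[OF f(1)])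
    moreover have "?fib a \<noteq> {}"
      using a' unfolding f(2)[symmetric] by blast
    ultimately show "closedin X G \<and> G \<noteq> {}"
      using a(2) by simp
  qed
  obtain B where B: "closedin X B" "\<forall>G\<in>?fib ` A. G \<inter> B \<noteq> {}"
    and minB: "\<forall>U. openin X U \<and> U \<inter> B \<noteq> {} \<longrightarrow> (\<exists>G\<in>?fib ` A. G \<inter> B \<subseteq> U)"
    using minimal_closed_transversal[OF X fib] by (elim exE conjE) (rule that)
  have "B \<noteq> {}"
    using B(2) A(2) by blast
  then obtain U where U: "openin X U" "U \<inter> B \<noteq> {}" "ediam dX (U \<inter> B) \<le> ennreal (\<delta> / 2)"
    using cb \<delta>(1) B(1) unfolding CB_analysable_iff_closed_fragmented by (meson half_gt_zero)
  \<comment> \<open>The part of \<open>A\<close> not hit by \<open>B - U\<close> is open in \<open>A\<close>, and it is covered by the image of \<open>U \<inter> B\<close>.\<close>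
  let ?V = "topspace Y - f ` (B - U)"
  have "closedin X (B - U)"
    using B(1) U(1) by blast
  then have "openin Y ?V"
    using cm unfolding closed_map_def by blast
  moreover have "?V \<inter> A \<noteq> {}"
  proof -
    obtain a where a: "a \<in> A" "?fib a \<inter> B \<subseteq> U"
      using minB U(1,2) by blast
    then have "a \<notin> f ` (B - U)"
      using closedin_subset[OF B(1)] by blast
    then show ?thesis
      using a(1) closedin_subset[OF A(1)] by blast
  qed
  moreover have "ediam dY (?V \<inter> A) \<le> ennreal e"
    unfolding ediam_def
  proof (intro SUP_least)
    fix y z assume yz: "y \<in> ?V \<inter> A" "z \<in> ?V \<inter> A"
    have lift: "\<exists>x \<in> U \<inter> B. x \<in> topspace X \<and> f x = v" if v: "v \<in> ?V \<inter> A" for v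
    proof -
      obtain x where "x \<in> B" "x \<in> topspace X" "f x = v"
        using bspec[OF B(2) imageI[of v A]] v by auto
      then show ?thesis
        using v by blast
    qed
    obtain x x' where x: "x \<in> U \<inter> B" "x \<in> topspace X" "f x = y"
      and x': "x' \<in> U \<inter> B" "x' \<in> topspace X" "f x' = z"
      using lift[OF yz(1)] lift[OF yz(2)] by blast
    have "dX x x' \<le> ediam dX (U \<inter> B)"
      unfolding ediam_def using x(1) x'(1) by (meson SUP_upper2 order_refl)
    also have "\<dots> < ennreal \<delta>"
      using U(3) \<delta>(1) by (simp add: ennreal_lessI order_le_less_trans)
    finally show "dY y z \<le> ennreal e"
      using \<delta>(2)[OF x(2) x'(2)] x(3) x'(3) by auto
  qed
  ultimately show "\<exists>V. openin Y V \<and> V \<inter> A \<noteq> {} \<and> ediam dY (V \<inter> A) \<le> ennreal e"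
    by blast
qed

text \<open>A precise map is 1-Lipschitz, since \<open>x'\<close> lies in the fibre of its own image.\<close>

lemma precise_quotient_imp_homomorphic_image:
  assumes "precise_quotient X dX Y dY \<pi>"
  shows "homomorphic_image X dX Y dY"
proof -
  have \<pi>: "topometric_space Y dY" "continuous_map X Y \<pi>" "\<pi> ` topspace X = topspace Y"
    and precise: "precise_map X dX Y dY \<pi>"
    using assms unfolding precise_quotient_def by auto
  have "dY (\<pi> x) (\<pi> x') \<le> dX x x'" if "x \<in> topspace X" "x' \<in> topspace X" for x x'
  proof -
    have "dY (\<pi> x) (\<pi> x') = dist_to_set dX x {z \<in> topspace X. \<pi> z = \<pi> x'}"
      using precise that \<pi>(3) unfolding precise_map_def by blast
    also have "\<dots> \<le> dX x x'"
      unfolding dist_to_set_def using that by (intro INF_lower) auto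
    finally show ?thesis .
  qed
  then have "topometric_morphism X dX Y dY \<pi>"
    unfolding topometric_morphism_def using \<pi>(2) by (meson order_le_less_trans)
  then show ?thesis
    unfolding homomorphic_image_def using \<pi> by blast
qed

section \<open>Copies along an injection\<close>

text \<open>The copy is a precise quotient of the original, and the original is a homomorphic image of the
  copy. Hence it suffices to test the quotients carried by a type into which the space embeds.\<close>

lemma isometric_copy:
  fixes X :: "'a topology" and emb :: "'a \<Rightarrow> 'c"
  assumes X: "topometric_space X d" and inj: "inj_on emb (topspace X)"
  obtains Y dY where "precise_quotient X d Y dY emb" and "homomorphic_image Y dY X d"
proof -
  let ?h = "inv_into (topspace X) emb"
  let ?S = "emb ` topspace X"
  let ?Y = "pullback_topology ?S ?h X"
  let ?d = "\<lambda>a b. d (?h a) (?h b)"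
  have h [simp]: "?h (emb x) = x" if "x \<in> topspace X" for x
    using inv_into_f_f[OF inj that] .
  have S: "topspace ?Y = ?S"
    by (auto simp: topspace_pullback_topology)
  have "continuous_map ?Y X (id \<circ> ?h)"
    by (intro continuous_map_pullback continuous_map_id)
  then have ch: "continuous_map ?Y X ?h"
    by simp
  have hS: "?h ` ?S = topspace X"
    by (force simp: image_image)
  have ce: "continuous_map X ?Y emb"
  proof (rule continuous_map_pullback')
    show "continuous_map X X (?h \<circ> emb)"
      by (rule continuous_map_eq[OF continuous_map_id]) auto
    show "topspace X \<subseteq> emb -` ?S"
      by blast
  qed
  have "topometric_space ?Y ?d"
    unfolding topometric_space_def
  proof (intro conjI allI impI)
    have "metric_on (topspace X) d"
      using X unfolding topometric_space_def by blast
    then show "metric_on (topspace ?Y) ?d"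
      unfolding metric_on_def S by (auto dest: inj_onD[OF inj])
  next
    fix U x assume "openin ?Y U \<and> x \<in> U"
    then obtain V where V: "openin X V" "U = ?h -` V \<inter> ?S" "x \<in> U"
      unfolding openin_pullback_topology by blast
    then have "?h x \<in> V"
      by blast
    then obtain r :: real where r: "r > 0" "{y \<in> topspace X. d (?h x) y < ennreal r} \<subseteq> V"
      using X V(1) unfolding topometric_space_def by blast
    then have "{y \<in> topspace ?Y. ?d x y < ennreal r} \<subseteq> U"
      unfolding S V(2) by auto
    with r(1) show "\<exists>r::real. r > 0 \<and> {y \<in> topspace ?Y. ?d x y < ennreal r} \<subseteq> U"
      by blast
  next
    fix r :: real assume "r \<ge> 0"
    then have "closedin (prod_topology X X) {(a, b). a \<in> topspace X \<and> b \<in> topspace X \<and> d a b \<le> ennreal r}"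
      using X unfolding topometric_space_def by blast
    moreover have "continuous_map (prod_topology ?Y ?Y) (prod_topology X X) (\<lambda>(a, b). (?h a, ?h b))"
      using continuous_map_prod_top[of ?Y ?Y X X ?h ?h] ch by simp
    ultimately have "closedin (prod_topology ?Y ?Y) {p \<in> topspace (prod_topology ?Y ?Y).
        (\<lambda>(a, b). (?h a, ?h b)) p \<in> {(a, b). a \<in> topspace X \<and> b \<in> topspace X \<and> d a b \<le> ennreal r}}"
      by (intro closedin_continuous_map_preimage)
    moreover have "{p \<in> topspace (prod_topology ?Y ?Y).
        (\<lambda>(a, b). (?h a, ?h b)) p \<in> {(a, b). a \<in> topspace X \<and> b \<in> topspace X \<and> d a b \<le> ennreal r}}
      = {(a, b). a \<in> topspace ?Y \<and> b \<in> topspace ?Y \<and> ?d a b \<le> ennreal r}"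
      unfolding topspace_prod_topology S by auto
    ultimately show "closedin (prod_topology ?Y ?Y)
        {(a, b). a \<in> topspace ?Y \<and> b \<in> topspace ?Y \<and> ?d a b \<le> ennreal r}"
      by simp
  qed
  moreover have "precise_map X d ?Y ?d emb"
    unfolding precise_map_def S
  proof (intro ballI)
    fix x y assume x: "x \<in> topspace X" and "y \<in> ?S"
    then obtain z where z: "z \<in> topspace X" "y = emb z"
      by blast
    then have "{x' \<in> topspace X. emb x' = y} = {z}"
      using inj unfolding inj_on_def by blast
    then show "?d (emb x) y = dist_to_set d x {x' \<in> topspace X. emb x' = y}"
      using x z by (simp add: dist_to_set_def)
  qed
  ultimately have "precise_quotient X d ?Y ?d emb"
    unfolding precise_quotient_def using ce S by blast
  moreover have "homomorphic_image ?Y ?d X d"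
    unfolding homomorphic_image_def topometric_morphism_def
    using X ch hS S by (intro conjI exI[of _ ?h]) auto
  ultimately show thesis
    by (rule that)
qed

section \<open>Countably many functions witness non-analysability\<close>

text \<open>In a minimal closed set meeting all members of \<open>\<G>\<close>, an open piece contains the trace of some
  member, hence also the nonempty traces of the two distant members below it.\<close>

lemma not_CB_analysable_if_splitting:
  assumes Y: "compact_space Y" and e: "e > 0" and ne: "\<G> \<noteq> {}"
    and \<G>: "\<forall>G\<in>\<G>. closedin Y G \<and> G \<noteq> {}"
    and split: "\<And>G. G \<in> \<G> \<Longrightarrow>
      \<exists>G0\<in>\<G>. \<exists>G1\<in>\<G>. G0 \<subseteq> G \<and> G1 \<subseteq> G \<and> (\<forall>y\<in>G0. \<forall>z\<in>G1. ennreal e \<le> dY y z)"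
  shows "\<not> CB_analysable Y dY"
proof
  assume cb: "CB_analysable Y dY"
  obtain B where B: "closedin Y B" "\<forall>G\<in>\<G>. G \<inter> B \<noteq> {}"
    and minB: "\<forall>U. openin Y U \<and> U \<inter> B \<noteq> {} \<longrightarrow> (\<exists>G\<in>\<G>. G \<inter> B \<subseteq> U)"
    using minimal_closed_transversal[OF Y \<G>] by (elim exE conjE) (rule that)
  have "B \<noteq> {}"
    using B(2) ne by blast
  then obtain U where U: "openin Y U" "U \<inter> B \<noteq> {}" "ediam dY (U \<inter> B) \<le> ennreal (e / 2)"
    using cb e B(1) unfolding CB_analysable_iff_closed_fragmented by (meson half_gt_zero)
  obtain G where "G \<in> \<G>" "G \<inter> B \<subseteq> U"
    using minB U(1,2) by blast
  then obtain G0 G1 where G01: "G0 \<in> \<G>" "G1 \<in> \<G>" "G0 \<subseteq> G" "G1 \<subseteq> G"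
      "\<forall>y\<in>G0. \<forall>z\<in>G1. ennreal e \<le> dY y z"
    using split by meson
  obtain y z where yz: "y \<in> G0 \<inter> B" "z \<in> G1 \<inter> B"
    using B(2) G01(1,2) by blast
  have "ennreal e \<le> dY y z"
    using G01(5) yz by blast
  also have "\<dots> \<le> ediam dY (U \<inter> B)"
    unfolding ediam_def using yz G01(3,4) \<open>G \<inter> B \<subseteq> U\<close> by (intro SUP_upper2[of y] SUP_upper) auto
  also have "\<dots> < ennreal e"
    using U(3) e by (simp add: ennreal_lessI order_le_less_trans)
  finally show False
    by simp
qed

lemma separating_function:
  assumes "compact_space X" "Hausdorff_space X" and U: "openin X U" "x \<in> U"
  obtains g where "g \<in> C01 X" "g x = 0" "\<And>z. \<lbrakk>z \<in> topspace X; g z < 1\<rbrakk> \<Longrightarrow> z \<in> U"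
proof -
  have "completely_regular_space X"
    using assms(1,2)
    by (simp add: normal_imp_completely_regular_space_A compact_Hausdorff_or_regular_imp_normal_space
        Hausdorff_imp_t1_space)
  moreover have x: "x \<in> topspace X"
    using U openin_subset by blast
  moreover have "closedin X (topspace X - U)"
    using U(1) by blast
  ultimately obtain f where f: "continuous_map X (top_of_set {0..1::real}) f"
      "f x = 0" "f ` (topspace X - U) \<subseteq> {1}"
    using U(2) unfolding completely_regular_space_def by blast
  let ?g = "restrict f (topspace X)"
  have "continuous_map X (top_of_set {0..1::real}) ?g"
    by (rule continuous_map_eq[OF f(1)]) simp
  then have "?g \<in> C01 X"
    unfolding C01_def by simp
  moreover have "?g x = 0"
    using f(2) x by simp
  moreover have "z \<in> U" if "z \<in> topspace X" "?g z < 1" for z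
    using that f(3) by (cases "z \<in> U") auto
  ultimately show thesis
    by (rule that)
qed

lemma C01_sublevel_open:
  assumes "g \<in> C01 X" shows "openin X {x \<in> topspace X. g x < (c::real)}"
proof -
  have "continuous_map X euclideanreal g"
    using assms unfolding C01_def by (auto dest: continuous_map_into_fulltopology)
  then have "openin X {x \<in> topspace X. g x \<in> {..<c}}"
    by (rule openin_continuous_map_preimage) auto
  then show ?thesis
    by simp
qed

lemma C01_sublevel_closed:
  assumes "g \<in> C01 X" shows "closedin X {x \<in> topspace X. g x \<le> (c::real)}"
proof -
  have "continuous_map X euclideanreal g"
    using assms unfolding C01_def by (auto dest: continuous_map_into_fulltopology)
  then have "closedin X {x \<in> topspace X. g x \<in> {..c}}"
    by (rule closedin_continuous_map_preimage) auto
  then show ?thesis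
    by simp
qed

text \<open>The level \<open>1 / 2\<close> stands for any number strictly between \<open>0\<close> and \<open>1\<close>, the two values prescribed
  by \<open>separating_function\<close>.\<close>

definition splits_sublevel ::
  "'a topology \<Rightarrow> ('a \<Rightarrow> 'a \<Rightarrow> ennreal) \<Rightarrow> real \<Rightarrow> ('a \<Rightarrow> real) \<Rightarrow> ('a \<Rightarrow> real) \<Rightarrow> ('a \<Rightarrow> real) \<Rightarrow> bool"
  where
  "splits_sublevel X d e g g0 g1 \<longleftrightarrow>
      (\<forall>x\<in>topspace X. g0 x \<le> 1 / 2 \<longrightarrow> g x \<le> 1 / 2) \<and>
      (\<forall>x\<in>topspace X. g1 x \<le> 1 / 2 \<longrightarrow> g x \<le> 1 / 2) \<and>
      (\<forall>x\<in>topspace X. \<forall>y\<in>topspace X. g0 x \<le> 1 / 2 \<and> g1 y \<le> 1 / 2 \<longrightarrow> ennreal e \<le> d x y)"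

text \<open>One step of the construction of the tree. The invariant refers to the open sublevel set, where
  the absence of small open pieces of \<open>A\<close> can be used again; the conclusion controls the larger
  closed sublevel sets, which are the members of the tree.\<close>

lemma split_sublevel:
  assumes X: "compact_space X" "topometric_space X d"
    and big: "\<And>U. \<lbrakk>openin X U; U \<inter> A \<noteq> {}\<rbrakk> \<Longrightarrow> \<not> ediam d (U \<inter> A) \<le> ennreal e"
    and A: "A \<subseteq> topspace X" and e: "e > 0"
    and g: "g \<in> C01 X" "\<exists>x\<in>A. g x < 1 / 2"
  shows "\<exists>g0 g1. g0 \<in> C01 X \<and> (\<exists>x\<in>A. g0 x < 1 / 2) \<and> g1 \<in> C01 X \<and> (\<exists>x\<in>A. g1 x < 1 / 2) \<and>
    splits_sublevel X d e g g0 g1"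
proof -
  let ?U = "{x \<in> topspace X. g x < 1 / 2}"
  have U: "openin X ?U"
    by (rule C01_sublevel_open[OF g(1)])
  moreover have "?U \<inter> A \<noteq> {}"
    using g(2) A by blast
  ultimately have "\<not> ediam d (?U \<inter> A) \<le> ennreal e"
    by (rule big)
  then obtain x y where xy: "x \<in> ?U \<inter> A" "y \<in> ?U \<inter> A" "\<not> d x y \<le> ennreal e"
    unfolding ediam_def by (meson SUP_least)
  let ?C = "{(a, b). a \<in> topspace X \<and> b \<in> topspace X \<and> d a b \<le> ennreal e}"
  have "closedin (prod_topology X X) ?C"
    using X(2) e unfolding topometric_space_def by auto
  then have "openin (prod_topology X X) (topspace (prod_topology X X) - ?C)"
    by blast
  moreover have "(x, y) \<in> topspace (prod_topology X X) - ?C"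
    using xy by auto
  ultimately obtain V W where VW: "openin X V" "openin X W" "x \<in> V" "y \<in> W"
      "V \<times> W \<subseteq> topspace (prod_topology X X) - ?C"
    unfolding openin_prod_topology_alt by meson
  have T2: "Hausdorff_space X"
    by (rule topometric_space_imp_Hausdorff[OF X(2)])
  obtain g0 where g0: "g0 \<in> C01 X" "g0 x = 0" "\<And>z. \<lbrakk>z \<in> topspace X; g0 z < 1\<rbrakk> \<Longrightarrow> z \<in> ?U \<inter> V"
    using separating_function[OF X(1) T2, of "?U \<inter> V" x] U VW xy by blast
  obtain g1 where g1: "g1 \<in> C01 X" "g1 y = 0" "\<And>z. \<lbrakk>z \<in> topspace X; g1 z < 1\<rbrakk> \<Longrightarrow> z \<in> ?U \<inter> W"
    using separating_function[OF X(1) T2, of "?U \<inter> W" y] U VW xy by blast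
  show ?thesis
    unfolding splits_sublevel_def
  proof (intro exI conjI ballI impI)
    show "g0 \<in> C01 X" "g1 \<in> C01 X"
      by fact+
    show "\<exists>x\<in>A. g0 x < 1 / 2" "\<exists>x\<in>A. g1 x < 1 / 2"
      using g0(2) g1(2) xy by (auto intro: bexI[of _ x] bexI[of _ y])
    show "g z \<le> 1 / 2" if "z \<in> topspace X" "g0 z \<le> 1 / 2" for z
      using g0(3)[of z] that by auto
    show "g z \<le> 1 / 2" if "z \<in> topspace X" "g1 z \<le> 1 / 2" for z
      using g1(3)[of z] that by auto
    show "ennreal e \<le> d a b" if "a \<in> topspace X" "b \<in> topspace X" "g0 a \<le> 1 / 2 \<and> g1 b \<le> 1 / 2" for a b
    proof -
      have "(a, b) \<in> V \<times> W"
        using g0(3)[of a] g1(3)[of b] that by auto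
      then have "(a, b) \<notin> ?C"
        using VW(5) by blast
      then show ?thesis
        using that by auto
    qed
  qed
qed

lemma countable_splitting_functions:
  assumes X: "compact_space X" "topometric_space X d" and nCB: "\<not> CB_analysable X d"
  obtains e :: real and \<B> where "e > 0" "\<B> \<subseteq> C01 X" "countable \<B>" "\<B> \<noteq> {}"
    and "\<And>g. g \<in> \<B> \<Longrightarrow> \<exists>x\<in>topspace X. g x \<le> 1 / 2"
    and "\<And>g. g \<in> \<B> \<Longrightarrow> \<exists>g0\<in>\<B>. \<exists>g1\<in>\<B>. splits_sublevel X d e g g0 g1"
proof -
  obtain e :: real and A where e: "e > 0" and A: "closedin X A" "A \<noteq> {}"
    and big: "\<And>U. \<lbrakk>openin X U; U \<inter> A \<noteq> {}\<rbrakk> \<Longrightarrow> \<not> ediam d (U \<inter> A) \<le> ennreal e"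
    using nCB unfolding CB_analysable_iff_closed_fragmented by meson
  have AX: "A \<subseteq> topspace X"
    by (rule closedin_subset[OF A(1)])
  define good where "good g \<longleftrightarrow> g \<in> C01 X \<and> (\<exists>x\<in>A. g x < 1 / 2)" for g :: "'a \<Rightarrow> real"
  have "\<exists>g0 g1. good g0 \<and> good g1 \<and> splits_sublevel X d e g g0 g1" if "good g" for g
    using split_sublevel[OF X big AX e, of g] that unfolding good_def by blast
  then have "\<forall>g. \<exists>q. good g \<longrightarrow> good (fst q) \<and> good (snd q) \<and> splits_sublevel X d e g (fst q) (snd q)"
    by simp
  from choice[OF this] obtain q where q: "\<forall>g. good g \<longrightarrow>
      good (fst (q g)) \<and> good (snd (q g)) \<and> splits_sublevel X d e g (fst (q g)) (snd (q g))"
    by (rule exE)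
  define p where "p b g = (if b then snd (q g) else fst (q g))" for b g
  have p: "good (p False g) \<and> good (p True g) \<and> splits_sublevel X d e g (p False g) (p True g)" if "good g" for g
    using q that by (simp add: p_def)
  define zero :: "'a \<Rightarrow> real" where "zero = restrict (\<lambda>_. 0) (topspace X)"
  have "continuous_map X (top_of_set {0..1}) zero"
    unfolding zero_def by (rule continuous_map_eq[of _ _ "\<lambda>_. 0"]) auto
  then have "zero \<in> C01 X"
    unfolding C01_def by (simp add: zero_def)
  moreover obtain a where "a \<in> A"
    using A(2) by blast
  moreover have "zero a < 1 / 2"
    using \<open>a \<in> A\<close> AX by (auto simp: zero_def)
  ultimately have zero: "good zero"
    unfolding good_def by blast
  \<comment> \<open>The nodes of the tree are indexed by finite binary sequences.\<close>
  define \<B> where "\<B> = range (\<lambda>s. foldr p s zero)"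
  have goodB: "good g" if "g \<in> \<B>" for g
  proof -
    have "good (foldr p s zero)" for s
    proof (induction s)
      case Nil
      then show ?case using zero by simp
    next
      case (Cons b s)
      then show ?case using p by (cases b) auto
    qed
    then show ?thesis
      using that unfolding \<B>_def by blast
  qed
  have child: "p b g \<in> \<B>" if g: "g \<in> \<B>" for b g
  proof -
    obtain s where "g = foldr p s zero"
      using g unfolding \<B>_def by blast
    then have "p b g = foldr p (b # s) zero"
      by simp
    then show ?thesis
      unfolding \<B>_def by blast
  qed
  show thesis
  proof (rule that[of e \<B>])
    show "e > 0" by (rule e)
    show "\<B> \<subseteq> C01 X" using goodB unfolding good_def by blast
    show "countable \<B>" unfolding \<B>_def by simp
    show "\<B> \<noteq> {}" unfolding \<B>_def by simp
    show "\<exists>x\<in>topspace X. g x \<le> 1 / 2" if g: "g \<in> \<B>" for g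
    proof -
      obtain x where "x \<in> A" "g x < 1 / 2"
        using goodB[OF g] unfolding good_def by blast
      then show ?thesis
        using AX by (intro bexI[of _ x]) auto
    qed
    show "\<exists>g0\<in>\<B>. \<exists>g1\<in>\<B>. splits_sublevel X d e g g0 g1"
      if "g \<in> \<B>" for g
      using child[OF that] p[OF goodB[OF that]] by blast
  qed
qed

lemma has_countable_base_if_weight_le:
  assumes w: "weight Y \<le>o |\<B>| +c natLeq" and "countable \<B>"
  shows "has_countable_base Y"
proof -
  have "|\<B>| \<le>o natLeq"
    using assms(2) by (simp add: countable_card_le_natLeq)
  then have "|\<B>| +c natLeq =o natLeq"
    by (simp add: csum_absorb2' natLeq_Card_order natLeq_cinfinite)
  then have "weight Y \<le>o natLeq"
    using w ordLeq_ordIso_trans by blast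
  moreover obtain B where "is_base Y B" "weight Y = |B|"
    using weight_is_least(1) by blast
  ultimately show ?thesis
    unfolding has_countable_base_def by (auto simp: countable_card_le_natLeq)
qed

text \<open>The sublevel sets of functions on \<open>X\<close> that factor via \<open>\<pi>\<close> are unions of fibres. Distances in a
  precise quotient are infima of distances between points and fibres, so a lower bound for the
  distances between two such sets passes to their images.\<close>

lemma not_CB_analysable_quotient_if_splitting:
  assumes X: "compact_space X" and q: "precise_quotient X d Y dY \<pi>"
    and e: "e > 0" and ne: "\<B> \<noteq> {}"
    and le: "\<And>g. g \<in> \<B> \<Longrightarrow> \<exists>x\<in>topspace X. g x \<le> 1 / 2"
    and split: "\<And>g. g \<in> \<B> \<Longrightarrow> \<exists>g0\<in>\<B>. \<exists>g1\<in>\<B>. splits_sublevel X d e g g0 g1"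
    and factor: "\<forall>g\<in>\<B>. \<exists>g'\<in>C01 Y. \<forall>x\<in>topspace X. g x = g' (\<pi> x)"
  shows "\<not> CB_analysable Y dY"
proof -
  have \<pi>: "continuous_map X Y \<pi>" "\<pi> ` topspace X = topspace Y"
    and precise: "precise_map X d Y dY \<pi>"
    using q unfolding precise_quotient_def by auto
  have "\<forall>g\<in>\<B>. \<exists>g'. g' \<in> C01 Y \<and> (\<forall>x\<in>topspace X. g x = g' (\<pi> x))"
    using factor by blast
  from bchoice[OF this] obtain F where F: "\<And>g. g \<in> \<B> \<Longrightarrow> F g \<in> C01 Y"
    "\<And>g x. \<lbrakk>g \<in> \<B>; x \<in> topspace X\<rbrakk> \<Longrightarrow> g x = F g (\<pi> x)"
    by blast
  let ?G = "\<lambda>g. {y \<in> topspace Y. F g y \<le> 1 / 2}"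
  have G: "?G g = \<pi> ` {x \<in> topspace X. g x \<le> 1 / 2}" if "g \<in> \<B>" for g
    using F(2)[OF that] unfolding \<pi>(2)[symmetric] by auto
  show ?thesis
  proof (rule not_CB_analysable_if_splitting[where \<G> = "?G ` \<B>", OF _ e])
    show "compact_space Y"
      using image_compactin[OF _ \<pi>(1), of "topspace X"] X \<pi>(2) by (simp add: compact_space_def)
    show "?G ` \<B> \<noteq> {}"
      using ne by blast
    show "\<forall>H\<in>?G ` \<B>. closedin Y H \<and> H \<noteq> {}"
    proof
      fix H assume H: "H \<in> ?G ` \<B>"
      obtain g where g: "g \<in> \<B>" "H = ?G g"
        using H by blast
      then show "closedin Y H \<and> H \<noteq> {}"
        using C01_sublevel_closed[OF F(1)[OF g(1)], of "1 / 2"] le[OF g(1)] G[OF g(1)] by auto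
    qed
    show "\<exists>G0\<in>?G ` \<B>. \<exists>G1\<in>?G ` \<B>. G0 \<subseteq> H \<and> G1 \<subseteq> H \<and> (\<forall>y\<in>G0. \<forall>z\<in>G1. ennreal e \<le> dY y z)"
      if H: "H \<in> ?G ` \<B>" for H
    proof -
      obtain g where g: "g \<in> \<B>" "H = ?G g"
        using H by blast
      obtain g0 g1 where g01: "g0 \<in> \<B>" "g1 \<in> \<B>"
        and s0: "\<And>x. \<lbrakk>x \<in> topspace X; g0 x \<le> 1 / 2\<rbrakk> \<Longrightarrow> g x \<le> 1 / 2"
        and s1: "\<And>x. \<lbrakk>x \<in> topspace X; g1 x \<le> 1 / 2\<rbrakk> \<Longrightarrow> g x \<le> 1 / 2"
        and far: "\<And>x y. \<lbrakk>x \<in> topspace X; y \<in> topspace X; g0 x \<le> 1 / 2; g1 y \<le> 1 / 2\<rbrakk> \<Longrightarrow> ennreal e \<le> d x y"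
        using split[OF g(1)] unfolding splits_sublevel_def by blast
      have "?G g0 \<subseteq> H"
        using s0 unfolding g(2) G[OF g(1)] G[OF g01(1)] by blast
      moreover have "?G g1 \<subseteq> H"
        using s1 unfolding g(2) G[OF g(1)] G[OF g01(2)] by blast
      moreover have "ennreal e \<le> dY y z" if y: "y \<in> ?G g0" and z: "z \<in> ?G g1" for y z
      proof -
        obtain x where x: "x \<in> topspace X" "g0 x \<le> 1 / 2" "y = \<pi> x"
          using y unfolding G[OF g01(1)] by blast
        have "ennreal e \<le> dist_to_set d x {x' \<in> topspace X. \<pi> x' = z}"
          unfolding dist_to_set_def
        proof (rule INF_greatest)
          fix x' assume "x' \<in> {x' \<in> topspace X. \<pi> x' = z}"
          then have x': "x' \<in> topspace X" "\<pi> x' = z"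
            by auto
          then have "g1 x' \<le> 1 / 2"
            using F(2)[OF g01(2) x'(1)] z by simp
          then show "ennreal e \<le> d x x'"
            using far x x' by blast
        qed
        also have "\<dots> = dY y z"
          using precise x z unfolding precise_map_def by simp
        finally show ?thesis .
      qed
      ultimately show ?thesis
        by (intro bexI[of _ "?G g0"] bexI[of _ "?G g1"] conjI ballI imageI g01)
    qed
  qed
qed

lemma CB_analysable_if_countable_quotients:
  assumes X: "topometric_space X d" "compact_space X" and Q: "sufficient_family X d \<Q>"
    and all: "\<forall>(Y, dY, \<pi>) \<in> \<Q>. has_countable_base Y \<longrightarrow> CB_analysable Y dY"
  shows "CB_analysable X d"
proof (rule ccontr)
  assume "\<not> CB_analysable X d"
  then obtain e :: real and \<B> where e: "e > 0" and \<B>: "\<B> \<subseteq> C01 X" "countable \<B>" "\<B> \<noteq> {}"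
    and le: "\<And>g. g \<in> \<B> \<Longrightarrow> \<exists>x\<in>topspace X. g x \<le> 1 / 2"
    and split: "\<And>g. g \<in> \<B> \<Longrightarrow> \<exists>g0\<in>\<B>. \<exists>g1\<in>\<B>. splits_sublevel X d e g g0 g1"
    using countable_splitting_functions[OF X(2,1)] by blast
  have "\<exists>(Y, dY, \<pi>) \<in> \<Q>. weight Y \<le>o |\<B>| +c natLeq \<and>
      (\<forall>g\<in>\<B>. \<exists>g'\<in>C01 Y. \<forall>x\<in>topspace X. g x = g' (\<pi> x))"
    using Q \<B>(1) unfolding sufficient_family_def by simp
  then obtain Y dY \<pi> where Y: "(Y, dY, \<pi>) \<in> \<Q>" "weight Y \<le>o |\<B>| +c natLeq"
      "\<forall>g\<in>\<B>. \<exists>g'\<in>C01 Y. \<forall>x\<in>topspace X. g x = g' (\<pi> x)"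
    by auto
  have "precise_quotient X d Y dY \<pi>"
    using Q Y(1) unfolding sufficient_family_def by auto
  then have "\<not> CB_analysable Y dY"
    by (rule not_CB_analysable_quotient_if_splitting[OF X(2) _ e \<B>(3) le split Y(3)])
  moreover have "has_countable_base Y"
    by (rule has_countable_base_if_weight_le[OF Y(2) \<B>(2)])
  ultimately show False
    using all Y(1) by blast
qed

section \<open>The equivalence\<close>

theorem theorem3p18:
  fixes X :: "'a topology" and d :: "'a \<Rightarrow> 'a \<Rightarrow> ennreal"
    and \<Q> :: "('a, 'b) quotient_data set"
    and emb :: "'a \<Rightarrow> 'c"
  assumes "topometric_space X d" and "compact_space X"
    and "enough_precise_quotients X d"
    and "sufficient_family X d \<Q>"
    and "inj_on emb (topspace X)"
  shows "(CB_analysable X d \<longleftrightarrow>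
           (\<forall>(Y :: 'c topology) dY. homomorphic_image X d Y dY \<longrightarrow> CB_analysable Y dY)) \<and>
         (CB_analysable X d \<longleftrightarrow>
           (\<forall>(Y :: 'c topology) dY \<pi>. precise_quotient X d Y dY \<pi> \<longrightarrow> CB_analysable Y dY)) \<and>
         (CB_analysable X d \<longleftrightarrow>
           (\<forall>(Y, dY, \<pi>) \<in> \<Q>. has_countable_base Y \<longrightarrow> CB_analysable Y dY))"
proof -
  obtain X' :: "'c topology" and d' where X': "precise_quotient X d X' d' emb"
    and X_image: "homomorphic_image X' d' X d"
    using isometric_copy[OF assms(1,5)] by blast
  have "compact_space X'"
    using X' image_compactin[of X "topspace X" X' emb] assms(2)
    unfolding precise_quotient_def by (simp add: compact_space_def)
  then have X'_X: "CB_analysable X' d' \<Longrightarrow> CB_analysable X d"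
    using CB_analysable_homomorphic_image X_image by blast
  have image: "CB_analysable Y dY" if "CB_analysable X d" "homomorphic_image X d Y dY" for Y :: "'c topology" and dY
    by (rule CB_analysable_homomorphic_image[OF assms(2) that])
  have "CB_analysable X d \<longleftrightarrow>
      (\<forall>(Y :: 'c topology) dY. homomorphic_image X d Y dY \<longrightarrow> CB_analysable Y dY)"
    using image X'_X precise_quotient_imp_homomorphic_image[OF X'] by blast
  moreover have "CB_analysable X d \<longleftrightarrow>
      (\<forall>(Y :: 'c topology) dY \<pi>. precise_quotient X d Y dY \<pi> \<longrightarrow> CB_analysable Y dY)"
    using image X'_X X' precise_quotient_imp_homomorphic_image[of X d] by metis
  moreover have "CB_analysable X d \<longleftrightarrow>
      (\<forall>(Y, dY, \<pi>) \<in> \<Q>. has_countable_base Y \<longrightarrow> CB_analysable Y dY)"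
  proof
    assume cb: "CB_analysable X d"
    have "CB_analysable Y dY" if "(Y, dY, \<pi>) \<in> \<Q>" for Y dY \<pi>
    proof -
      have "precise_quotient X d Y dY \<pi>"
        using assms(4) that unfolding sufficient_family_def by auto
      then show ?thesis
        by (intro CB_analysable_homomorphic_image[OF assms(2) cb] precise_quotient_imp_homomorphic_image)
    qed
    then show "\<forall>(Y, dY, \<pi>) \<in> \<Q>. has_countable_base Y \<longrightarrow> CB_analysable Y dY"
      by auto
  next
    assume "\<forall>(Y, dY, \<pi>) \<in> \<Q>. has_countable_base Y \<longrightarrow> CB_analysable Y dY"
    then show "CB_analysable X d"
      by (rule CB_analysable_if_countable_quotients[OF assms(1,2,4)])
  qed
  ultimately show ?thesis
    by blast
qed

end
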